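(* Let $0<q<1$ and let $\max\{|xt|,|xs|\}<1$. Then $$\sum_{n=0}^\infty\sum_{m=0}^\infty p_{n+m}(x,y,a)\frac{t^n}{(q;q)_n}\frac{s^m}{(q;q)_m}=\frac{1}{(xt,xs;q)_\infty}\sum_{n=0}^\infty\frac{(-1)^nq^{\binom n2}(a;q)_n(sy)^n}{(q;q)_n}\;{}_2\Phi_1\left(\begin{array}{c}aq^n,\,xs\\0\end{array}\Big|\,q;ytq^n\right).$$
   Context: For complex $c$: $(c;q)_0=1$, $(c;q)_n=\prod_{i=0}^{n-1}(1-cq^i)$, $(c;q)_\infty=\prod_{i=0}^\infty(1-cq^i)$, and $(c_1,\dots,c_r;q)_n=(c_1;q)_n\cdots(c_r;q)_n$ (also for $n=\infty$). The $q$-binomial coefficient is $\left[{n\atop k}\right]_q=\dfrac{(q;q)_n}{(q;q)_k(q;q)_{n-k}}$. The generalized Cauchy polynomials are $$p_n(x,y,a)=\sum_{k=0}^n\left[{n\atop k}\right]_q(-1)^kq^{\binom k2}(a;q)_k\,x^{n-k}y^k.$$ The basic hypergeometric series is $${}_r\Phi_s\left(\begin{array}{c}a_1,\dots,a_r\\ b_1,\dots,b_s\end{array}\Big|\,q;z\right)=\sum_{n=0}^\infty\Big[(-1)^nq^{\binom n2}\Big]^{1+s-r}\frac{(a_1,\dots,a_r;q)_n}{(b_1,\dots,b_s;q)_n}\frac{z^n}{(q;q)_n}.$$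
   Formalization: The printed formula with 2Φ1(aq^n, xs; 0 | q; ytq^n) is false (x=s=0, a=1/q, y=1, t=q gives 2 on the left, 0 on the right); the theorem proved has 2Φ2(aq^n, xs; 0, 0 | q; ytq^n) in its place, and also asserts convergence of all the series. *)

theory Defs
  imports "HOL-Analysis.Analysis"
begin

definition qpoch :: "complex \<Rightarrow> real \<Rightarrow> nat \<Rightarrow> complex" where
  "qpoch c q n = (\<Prod>i<n. 1 - c * complex_of_real q ^ i)"

definition qpoch_inf :: "complex \<Rightarrow> real \<Rightarrow> complex" where
  "qpoch_inf c q = (\<Prod>i. 1 - c * complex_of_real q ^ i)"

definition qpoch_list :: "complex list \<Rightarrow> real \<Rightarrow> nat \<Rightarrow> complex" where
  "qpoch_list cs q n = (\<Prod>c\<leftarrow>cs. qpoch c q n)"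

definition qpoch_inf_list :: "complex list \<Rightarrow> real \<Rightarrow> complex" where
  "qpoch_inf_list cs q = (\<Prod>c\<leftarrow>cs. qpoch_inf c q)"

text \<open>Only meaningful for \<open>k \<le> n\<close>, because of the truncated subtraction.\<close>
definition qbinom :: "real \<Rightarrow> nat \<Rightarrow> nat \<Rightarrow> complex" where
  "qbinom q n k = qpoch (of_real q) q n / (qpoch (of_real q) q k * qpoch (of_real q) q (n - k))"

definition gen_cauchy_poly ::
    "real \<Rightarrow> nat \<Rightarrow> complex \<Rightarrow> complex \<Rightarrow> complex \<Rightarrow> complex" where
  "gen_cauchy_poly q n x y a =
     (\<Sum>k\<le>n. qbinom q n k * (-1) ^ k * of_real q ^ (k choose 2) * qpoch a q k
              * x ^ (n - k) * y ^ k)"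

text \<open>The lists \<open>as\<close> and \<open>bs\<close> hold the \<open>r\<close> upper and \<open>s\<close> lower parameters. The exponent
  \<open>1 + s - r\<close> may be negative, hence the integer power.\<close>
definition bhyp_term ::
    "complex list \<Rightarrow> complex list \<Rightarrow> real \<Rightarrow> complex \<Rightarrow> nat \<Rightarrow> complex" where
  "bhyp_term as bs q z n =
     ((-1) ^ n * of_real q ^ (n choose 2)) powi (1 + int (length bs) - int (length as))
     * (qpoch_list as q n / qpoch_list bs q n) * (z ^ n / qpoch (of_real q) q n)"

definition bhyp :: "complex list \<Rightarrow> complex list \<Rightarrow> real \<Rightarrow> complex \<Rightarrow> complex" where
  "bhyp as bs q z = (\<Sum>n. bhyp_term as bs q z n)"

end

theory Submission
  imports Defs
begin

text \<open>
  Both sides of the identity are iterated sums of one absolutely convergent fourfold series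
  (\<open>fourfold_term\<close>), grouped in two different ways.

  On the left, the polynomial \<open>p\<^sub>n\<^sub>+\<^sub>m\<close> contains the Gaussian binomials with upper index \<open>n + m\<close>.
  The q-Vandermonde convolution (\<open>q_vandermonde_sum\<close>) splits them into products of a
  Gaussian binomial over \<open>n\<close> with lower index \<open>i\<close>, one over \<open>m\<close> with lower index \<open>l\<close>, and the
  power \<open>q\<close> to the \<open>i (m - l)\<close>. The numerators of these binomials cancel against the
  denominators of the generating function, and what remains depends on \<open>i\<close>, \<open>l\<close>,
  \<open>n' = n - i\<close> and \<open>m' = m - l\<close>, which are four free indices. The left-hand side is thus
  the fourfold series grouped by the values of \<open>(n, m)\<close>
  (\<open>gen_cauchy_poly_expansion\<close>).

  Now fix \<open>i\<close> and \<open>l\<close> instead. The sums over \<open>n'\<close> and \<open>m'\<close> are Euler series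
  (\<open>euler_sum\<close>) in \<open>x t\<close> and in \<open>x s q\<^sup>i\<close>; the
  latter argument absorbs the power \<open>q\<close> to the \<open>i m'\<close>. They give the reciprocals of the infinite
  products at \<open>x t\<close> and \<open>x s q\<^sup>i\<close>, and
  the second of these equals the reciprocal of the product at \<open>x s\<close> times the finite symbol
  \<open>(x s; q)\<^sub>i\<close>. Since \<open>(a; q)\<^sub>l\<^sub>+\<^sub>i\<close> is \<open>(a; q)\<^sub>l\<close> times \<open>(a q\<^sup>l; q)\<^sub>i\<close> and the exponent \<open>l + i\<close> choose 2 is
  \<open>l\<close> choose 2 plus \<open>i\<close> choose 2 plus \<open>i l\<close>, summing over \<open>i\<close> produces the basic
  hypergeometric series of the right-hand side (\<open>outer_coeff_bhyp_term\<close>), with \<open>l\<close> as its outer index.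

  Absolute convergence (\<open>fourfold_summable\<close>) legitimises the regrouping: the finite
  Pochhammer symbols are bounded, and so are the reciprocals of \<open>(q; q)\<^sub>n\<close>, because
  \<open>(q; q)\<^sub>\<infinity>\<close> is nonzero. Each term is therefore dominated by a product of two geometric terms in
  \<open>n'\<close> and \<open>m'\<close> and two terms with Gaussian decay in \<open>i\<close> and \<open>l\<close>.
\<close>

section \<open>Finite and infinite q-Pochhammer symbols\<close>

lemma qpoch_0 [simp]: "qpoch c q 0 = 1"
  by (simp add: qpoch_def)

lemma qpoch_Suc: "qpoch c q (Suc n) = qpoch c q n * (1 - c * of_real q ^ n)"
  by (simp add: qpoch_def)

lemma qpoch_zero [simp]: "qpoch 0 q n = 1"
  by (simp add: qpoch_def)

lemma qpoch_add: "qpoch c q (n + k) = qpoch c q n * qpoch (c * of_real q ^ n) q k"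
  by (induction k) (simp_all add: qpoch_Suc power_add mult.assoc)

lemma norm_mult_power_le:
  assumes "0 < q" "q < 1"
  shows "norm (c * complex_of_real q ^ n) \<le> norm c"
proof -
  have "norm c * q ^ n \<le> norm c * 1"
    using assms by (intro mult_left_mono) (auto simp: power_le_one)
  thus ?thesis using assms by (simp add: norm_mult norm_power)
qed

lemma qpoch_factor_nonzero:
  assumes "0 < q" "q < 1" "norm c < 1"
  shows "1 - c * complex_of_real q ^ i \<noteq> 0"
proof
  assume "1 - c * complex_of_real q ^ i = 0"
  hence "norm (c * complex_of_real q ^ i) = 1"
    by (metis eq_iff_diff_eq_0 norm_one)
  thus False using norm_mult_power_le[OF assms(1,2), of c i] assms(3) by simp
qed

lemma qpoch_self_nonzero [simp]:
  assumes "0 < q" "q < 1"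
  shows "qpoch (of_real q) q n \<noteq> 0"
  using qpoch_factor_nonzero[of q "of_real q"] assms by (simp add: qpoch_def)

lemma convergent_prod_qpoch:
  assumes "0 < q" "q < 1"
  shows "convergent_prod (\<lambda>i. 1 - c * complex_of_real q ^ i)"
proof -
  have "summable (\<lambda>i. norm c * q ^ i)"
    using assms by (intro summable_mult summable_geometric) auto
  hence "summable (\<lambda>i. norm ((1 - c * complex_of_real q ^ i) - 1))"
    using assms by (simp add: norm_mult norm_power)
  thus ?thesis
    by (intro abs_convergent_prod_imp_convergent_prod) (simp add: abs_convergent_prod_conv_summable)
qed

lemma qpoch_tendsto:
  assumes "0 < q" "q < 1"
  shows "qpoch c q \<longlonglongrightarrow> qpoch_inf c q"
  using convergent_prod_LIMSEQ[OF convergent_prod_qpoch[OF assms, of c]]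
  unfolding qpoch_def qpoch_inf_def by (simp add: LIMSEQ_lessThan_iff_atMost)

text \<open>No factor vanishes, and a convergent infinite product is zero only if one of its factors is.\<close>

lemma qpoch_inf_nonzero:
  assumes "0 < q" "q < 1" "norm c < 1"
  shows "qpoch_inf c q \<noteq> 0"
  unfolding qpoch_inf_def using assms
  by (intro prodinf_nonzero convergent_prod_qpoch qpoch_factor_nonzero)

lemma qpoch_inf_split:
  assumes "0 < q" "q < 1"
  shows "qpoch_inf c q = qpoch c q n * qpoch_inf (c * of_real q ^ n) q"
proof (rule LIMSEQ_unique)
  show "(\<lambda>k. qpoch c q (k + n)) \<longlonglongrightarrow> qpoch_inf c q"
    by (rule LIMSEQ_ignore_initial_segment[OF qpoch_tendsto[OF assms]])
  show "(\<lambda>k. qpoch c q (k + n)) \<longlonglongrightarrow> qpoch c q n * qpoch_inf (c * of_real q ^ n) q"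
    unfolding add.commute[of _ n] qpoch_add by (intro tendsto_mult tendsto_const qpoch_tendsto assms)
qed

lemma qpoch_bounded:
  assumes "0 < q" "q < 1"
  obtains M where "M > 0" "\<And>n. norm (qpoch c q n) \<le> M"
  using convergent_imp_Bseq[OF convergentI[OF qpoch_tendsto[OF assms, of c]]]
  unfolding Bseq_def by blast

text \<open>The symbols \<open>(q; q)\<^sub>n\<close> stay away from zero, because their limit is nonzero.\<close>

lemma inverse_qpoch_self_bounded:
  assumes "0 < q" "q < 1"
  obtains M where "M > 0" "\<And>n. norm (inverse (qpoch (of_real q) q n)) \<le> M"
proof -
  have "(\<lambda>n. inverse (qpoch (of_real q) q n)) \<longlonglongrightarrow> inverse (qpoch_inf (of_real q) q)"
    using assms by (intro tendsto_inverse qpoch_tendsto qpoch_inf_nonzero) auto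
  from convergent_imp_Bseq[OF convergentI[OF this]] show ?thesis
    using that unfolding Bseq_def by blast
qed

section \<open>Euler's expansion of the reciprocal infinite product\<close>

lemma euler_summable:
  assumes "0 < q" "q < 1" "norm z < 1"
  shows "summable (\<lambda>n. norm (z ^ n / qpoch (of_real q) q n))"
proof -
  obtain M where M: "M > 0" "\<And>n. norm (inverse (qpoch (of_real q) q n)) \<le> M"
    using inverse_qpoch_self_bounded[OF assms(1,2)] by blast
  show ?thesis
  proof (rule summable_comparison_test)
    show "summable (\<lambda>n. norm z ^ n * M)"
      using assms by (intro summable_mult2 summable_geometric) auto
    show "\<exists>N. \<forall>n\<ge>N. norm (norm (z ^ n / qpoch (of_real q) q n)) \<le> norm z ^ n * M"
      unfolding divide_inverse using M
      by (auto simp: norm_mult norm_power simp del: norm_inverse intro!: mult_left_mono)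
  qed
qed

text \<open>
  The sum \<open>F\<close> of the series satisfies \<open>F (q w) = (1 - w) F w\<close>: in \<open>F w - F (q w)\<close> the \<open>n\<close>-th
  coefficient gains the factor \<open>1 - q\<^sup>n\<close>, which cancels the last factor of \<open>(q; q)\<^sub>n\<close> and shifts
  the series by one. Iterating gives \<open>F (z q\<^sup>n) = (z; q)\<^sub>n F z\<close>, and letting \<open>n\<close> tend to infinity,
  with \<open>F\<close> continuous at \<open>0\<close>, gives \<open>1 = (z; q)\<^sub>\<infinity> F z\<close>.
\<close>

lemma euler_sum:
  assumes "0 < q" "q < 1" "norm z < 1"
  shows "(\<lambda>n. z ^ n / qpoch (of_real q) q n) sums (1 / qpoch_inf z q)"
proof -
  define e where "e = (\<lambda>n. 1 / qpoch (of_real q) q n)"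
  define F where "F = (\<lambda>w. \<Sum>n. e n * w ^ n)"
  have e0: "e 0 = 1" by (simp add: e_def)
  have e_Suc: "e (Suc n) * (1 - of_real q ^ Suc n) = e n" for n
    using qpoch_self_nonzero[OF assms(1,2), of n] qpoch_self_nonzero[OF assms(1,2), of "Suc n"]
    by (simp add: e_def qpoch_Suc field_simps)
  have summ: "summable (\<lambda>n. e n * w ^ n)" if "norm w < 1" for w
    using summable_norm_cancel[OF euler_summable[OF assms(1,2) that]] by (simp add: e_def)
  have small: "norm (z * of_real q ^ n) < 1" for n
    using norm_mult_power_le[OF assms(1,2), of z n] assms(3) by simp
  have step: "F (w * of_real q) = (1 - w) * F w" if w: "norm w < 1" for w
  proof -
    have w': "norm (w * of_real q) < 1"
      using mult_strict_mono[of "norm w" 1 q 1] assms w by (simp add: norm_mult)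
    have "F w - F (w * of_real q) = (\<Sum>n. e n * w ^ n - e n * (w * of_real q) ^ n)"
      unfolding F_def by (intro suminf_diff summ w w')
    also have "\<dots> = (\<Sum>n. e (Suc n) * w ^ Suc n - e (Suc n) * (w * of_real q) ^ Suc n)"
      using suminf_split_head[OF summable_diff[OF summ[OF w] summ[OF w']]] by simp
    also have "\<dots> = (\<Sum>n. w * (e n * w ^ n))"
    proof (intro suminf_cong)
      fix n
      have "e (Suc n) * w ^ Suc n - e (Suc n) * (w * of_real q) ^ Suc n
              = (e (Suc n) * (1 - of_real q ^ Suc n)) * w ^ Suc n"
        by (simp add: power_mult_distrib algebra_simps)
      also have "\<dots> = w * (e n * w ^ n)"
        unfolding e_Suc by simp
      finally show "e (Suc n) * w ^ Suc n - e (Suc n) * (w * of_real q) ^ Suc n = w * (e n * w ^ n)" .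
    qed
    also have "\<dots> = w * F w"
      unfolding F_def by (intro suminf_mult summ w)
    finally show ?thesis by (simp add: algebra_simps)
  qed
  have iter: "F (z * of_real q ^ n) = qpoch z q n * F z" for n
  proof (induction n)
    case (Suc n)
    have "F (z * of_real q ^ Suc n) = F (z * of_real q ^ n * of_real q)"
      by (simp add: mult_ac)
    also have "\<dots> = qpoch z q (Suc n) * F z"
      by (subst step[OF small]) (simp add: Suc qpoch_Suc)
    finally show ?case .
  qed simp
  have "isCont F 0"
    unfolding F_def using summ[of "1/2"] by (intro isCont_powser[where K = "1/2"]) (auto simp: norm_divide)
  moreover have "(\<lambda>n. z * of_real q ^ n) \<longlonglongrightarrow> z * 0"
    using assms by (intro tendsto_mult tendsto_const LIMSEQ_power_zero) auto
  ultimately have "(\<lambda>n. F (z * of_real q ^ n)) \<longlonglongrightarrow> F 0"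
    by (intro isCont_tendsto_compose[of 0 F]) simp_all
  moreover have "(\<lambda>n. F (z * of_real q ^ n)) \<longlonglongrightarrow> qpoch_inf z q * F z"
    unfolding iter by (intro tendsto_mult tendsto_const qpoch_tendsto assms)
  ultimately have "qpoch_inf z q * F z = F 0"
    using LIMSEQ_unique by blast
  moreover have "F 0 = 1"
    unfolding F_def by (simp add: powser_zero e0)
  ultimately have "F z = 1 / qpoch_inf z q"
    using qpoch_inf_nonzero[OF assms] by (simp add: field_simps)
  thus ?thesis
    using summable_sums[OF summ[OF assms(3)]] by (simp add: F_def e_def)
qed

section \<open>The q-Vandermonde convolution\<close>

lemma qbinom_0 [simp]: "0 < q \<Longrightarrow> q < 1 \<Longrightarrow> qbinom q n 0 = 1"
  by (simp add: qbinom_def)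

lemma qbinom_self [simp]: "0 < q \<Longrightarrow> q < 1 \<Longrightarrow> qbinom q n n = 1"
  by (simp add: qbinom_def)

lemma qbinom_pascal:
  assumes "0 < q" "q < 1" "k < n"
  shows "qbinom q (Suc n) (Suc k) = qbinom q n (Suc k) + of_real q ^ (n - k) * qbinom q n k"
proof -
  obtain d where n: "n = Suc (k + d)"
    using less_imp_Suc_add[OF assms(3)] by blast
  define Q where "Q = complex_of_real q"
  define P where "P = (\<lambda>n. qpoch Q q n)"
  have nz: "P n \<noteq> 0" for n
    using assms by (simp add: P_def Q_def)
  have PS: "P (Suc n) = P n * (1 - Q ^ Suc n)" for n
    by (simp add: P_def qpoch_Suc Q_def)
  have nz': "1 - Q ^ Suc n \<noteq> 0" for n
    using nz[of "Suc n"] unfolding PS by simp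
  have "P (Suc n) / (P (Suc k) * P (Suc d))
          = P n * (1 - Q ^ Suc n) / (P k * (1 - Q ^ Suc k) * (P d * (1 - Q ^ Suc d)))"
    by (simp only: PS)
  also have "1 - Q ^ Suc n = (1 - Q ^ Suc d) + Q ^ Suc d * (1 - Q ^ Suc k)"
    unfolding n by (simp add: algebra_simps power_add)
  also have "P n * \<dots> / (P k * (1 - Q ^ Suc k) * (P d * (1 - Q ^ Suc d)))
      = P n / (P k * (1 - Q ^ Suc k) * P d) + Q ^ Suc d * (P n / (P k * (P d * (1 - Q ^ Suc d))))"
    using nz[of k] nz[of d] nz'[of k] nz'[of d] by (simp add: divide_simps) (simp add: algebra_simps)
  finally show ?thesis
    unfolding qbinom_def by (simp add: n P_def Q_def qpoch_Suc mult_ac)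
qed

text \<open>
  Pascal's rule for a linear functional of the Gaussian binomials. With an arbitrary weight \<open>g\<close> in
  place of a fixed lower index, the boundary terms \<open>j = 0\<close> and \<open>j = n + 1\<close> are absorbed into the sum.
\<close>

lemma qbinom_pascal_sum:
  fixes g :: "nat \<Rightarrow> complex"
  assumes "0 < q" "q < 1"
  shows "(\<Sum>j\<le>Suc n. qbinom q (Suc n) j * g j)
           = (\<Sum>j\<le>n. qbinom q n j * (g j + of_real q ^ (n - j) * g (Suc j)))"
proof -
  have "(\<Sum>j\<le>Suc n. qbinom q (Suc n) j * g j)
      = g 0 + (\<Sum>j<n. qbinom q (Suc n) (Suc j) * g (Suc j)) + g (Suc n)"
    unfolding lessThan_Suc_atMost[symmetric]
    by (subst sum.lessThan_Suc_shift) (simp add: assms)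
  also have "(\<Sum>j<n. qbinom q (Suc n) (Suc j) * g (Suc j))
      = (\<Sum>j<n. qbinom q n (Suc j) * g (Suc j))
        + (\<Sum>j<n. qbinom q n j * (of_real q ^ (n - j) * g (Suc j)))"
    unfolding sum.distrib[symmetric]
    by (intro sum.cong) (auto simp: qbinom_pascal[OF assms] algebra_simps)
  also have "g 0 + (\<dots>) + g (Suc n)
     = (g 0 + (\<Sum>j<n. qbinom q n (Suc j) * g (Suc j)))
        + ((\<Sum>j<n. qbinom q n j * (of_real q ^ (n - j) * g (Suc j))) + g (Suc n))"
    by simp
  also have "g 0 + (\<Sum>j<n. qbinom q n (Suc j) * g (Suc j)) = (\<Sum>j\<le>n. qbinom q n j * g j)"
    unfolding lessThan_Suc_atMost[symmetric]
    by (subst sum.lessThan_Suc_shift) (simp add: assms)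
  also have "(\<Sum>j<n. qbinom q n j * (of_real q ^ (n - j) * g (Suc j))) + g (Suc n)
      = (\<Sum>j\<le>n. qbinom q n j * (of_real q ^ (n - j) * g (Suc j)))"
    unfolding lessThan_Suc_atMost[symmetric] by (simp add: assms)
  finally show ?thesis
    by (simp add: sum.distrib distrib_left)
qed

text \<open>
  Taking \<open>g\<close> to be the indicator of one index gives the usual convolution; in the weighted form
  every lower index stays within its range. In the induction, one
  application of Pascal's rule turns the weight \<open>g\<close> into \<open>g j + q\<^sup>n\<^sup>+\<^sup>m\<^sup>-\<^sup>j g (j + 1)\<close>. The hypothesis
  applies to this new weight, and Pascal's rule used backwards in \<open>i\<close>
  collects the result, since for \<open>j = i + l\<close> the exponents \<open>i (m - l) + (n + m - j)\<close> and
  \<open>(n - i) + (i + 1) (m - l)\<close> agree.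
\<close>

lemma q_vandermonde_sum:
  fixes g :: "nat \<Rightarrow> complex"
  assumes "0 < q" "q < 1"
  shows "(\<Sum>j\<le>n + m. qbinom q (n + m) j * g j)
           = (\<Sum>i\<le>n. \<Sum>l\<le>m. qbinom q n i * qbinom q m l * of_real q ^ (i * (m - l)) * g (i + l))"
proof (induction n arbitrary: g)
  case 0
  show ?case by (simp add: assms)
next
  case (Suc n)
  let ?Q = "complex_of_real q"
  have "(\<Sum>j\<le>Suc n + m. qbinom q (Suc n + m) j * g j)
      = (\<Sum>j\<le>n + m. qbinom q (n + m) j * (g j + ?Q ^ (n + m - j) * g (Suc j)))"
    using qbinom_pascal_sum[OF assms, of "n + m" g] by simp
  also have "\<dots> = (\<Sum>i\<le>n. \<Sum>l\<le>m. qbinom q n i * qbinom q m l * ?Q ^ (i * (m - l))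
                     * (g (i + l) + ?Q ^ (n + m - (i + l)) * g (Suc (i + l))))"
    by (rule Suc.IH)
  also have "\<dots> = (\<Sum>i\<le>n. \<Sum>l\<le>m. qbinom q m l * (qbinom q n i * (?Q ^ (i * (m - l)) * g (i + l)
                     + ?Q ^ (n - i) * (?Q ^ (Suc i * (m - l)) * g (Suc i + l)))))"
  proof (intro sum.cong refl)
    fix i l assume "i \<in> {..n}" "l \<in> {..m}"
    hence "n + m - (i + l) = (n - i) + (m - l)" by simp
    hence "?Q ^ (i * (m - l)) * ?Q ^ (n + m - (i + l)) = ?Q ^ (n - i) * ?Q ^ (Suc i * (m - l))"
      by (simp add: power_add)
    thus "qbinom q n i * qbinom q m l * ?Q ^ (i * (m - l))
                     * (g (i + l) + ?Q ^ (n + m - (i + l)) * g (Suc (i + l)))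
       = qbinom q m l * (qbinom q n i * (?Q ^ (i * (m - l)) * g (i + l)
                     + ?Q ^ (n - i) * (?Q ^ (Suc i * (m - l)) * g (Suc i + l))))"
      by (simp add: distrib_left mult.assoc)
  qed
  also have "\<dots> = (\<Sum>l\<le>m. qbinom q m l * (\<Sum>i\<le>n. qbinom q n i * (?Q ^ (i * (m - l)) * g (i + l)
                     + ?Q ^ (n - i) * (?Q ^ (Suc i * (m - l)) * g (Suc i + l)))))"
    by (subst sum.swap) (simp add: sum_distrib_left)
  also have "\<dots> = (\<Sum>l\<le>m. qbinom q m l * (\<Sum>i\<le>Suc n. qbinom q (Suc n) i * (?Q ^ (i * (m - l)) * g (i + l))))"
    by (subst qbinom_pascal_sum[OF assms]) (rule refl)
  also have "\<dots> = (\<Sum>i\<le>Suc n. \<Sum>l\<le>m. qbinom q (Suc n) i * qbinom q m l * ?Q ^ (i * (m - l)) * g (i + l))"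
    by (subst sum.swap) (simp only: sum_distrib_left mult_ac)
  finally show ?case .
qed

section \<open>Summability\<close>

lemma choose_two_add: "(i + l) choose 2 = (i choose 2) + (l choose 2) + i * l"
proof (induction l)
  case (Suc l)
  have "Suc k choose 2 = k + (k choose 2)" for k
    by (simp add: numeral_2_eq_2)
  thus ?case using Suc by simp
qed simp

lemma summable_gaussian_power:
  fixes q r :: real
  assumes "0 < q" "q < 1"
  shows "summable (\<lambda>n. q ^ (n choose 2) * r ^ n)"
proof -
  have "(\<lambda>n. norm (q ^ n * r)) \<longlonglongrightarrow> norm (0 * r)"
    using assms by (intro tendsto_norm tendsto_mult tendsto_const LIMSEQ_power_zero) auto
  hence "\<forall>\<^sub>F n in sequentially. norm (q ^ n * r) < 1/2"
    by (rule order_tendstoD) simp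
  then obtain N where N: "\<And>n. n \<ge> N \<Longrightarrow> norm (q ^ n * r) < 1/2"
    by (auto simp: eventually_at_top_linorder)
  show ?thesis
  proof (rule summable_ratio_test[where c = "1/2" and N = N])
    fix n assume "n \<ge> N"
    have "q ^ (Suc n choose 2) * r ^ Suc n = (q ^ n * r) * (q ^ (n choose 2) * r ^ n)"
      using choose_two_add[of n 1] by (simp add: power_add mult_ac numeral_2_eq_2)
    hence "norm (q ^ (Suc n choose 2) * r ^ Suc n)
             = norm (q ^ n * r) * norm (q ^ (n choose 2) * r ^ n)"
      by (simp only: norm_mult)
    also have "\<dots> \<le> 1/2 * norm (q ^ (n choose 2) * r ^ n)"
      by (intro mult_right_mono less_imp_le[OF N] \<open>n \<ge> N\<close>) auto
    finally show "norm (q ^ (Suc n choose 2) * r ^ Suc n) \<le> 1/2 * norm (q ^ (n choose 2) * r ^ n)" .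
  qed simp
qed

lemma summable_on_Times_mult:
  fixes f :: "'a \<Rightarrow> real" and g :: "'b \<Rightarrow> real"
  assumes "f summable_on A" "g summable_on B" "\<And>x. f x \<ge> 0" "\<And>y. g y \<ge> 0"
  shows "(\<lambda>(x, y). f x * g y) summable_on (A \<times> B)"
proof -
  have "(\<lambda>p. norm (case p of (x, y) \<Rightarrow> f x * g y)) summable_on (A \<times> B)"
    unfolding Infinite_Sum.abs_summable_on_Sigma_iff using assms
    by (auto simp: abs_mult infsum_cmult_right' infsum_nonneg
             intro!: summable_on_cmult_right summable_on_cmult_left)
  thus ?thesis by (rule abs_summable_summable)
qed

lemma has_sum_Times_mult:
  fixes f :: "'a \<Rightarrow> complex" and g :: "'b \<Rightarrow> complex"
  assumes "(\<lambda>(x, y). f x * g y) summable_on (A \<times> B)" "(f has_sum u) A" "(g has_sum v) B"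
  shows "((\<lambda>(x, y). f x * g y) has_sum u * v) (A \<times> B)"
proof -
  obtain S where S: "((\<lambda>(x, y). f x * g y) has_sum S) (A \<times> B)"
    using assms(1) by (auto simp: summable_on_def)
  have "((\<lambda>x. f x * v) has_sum S) A"
    by (rule has_sum_SigmaD[OF S]) (auto intro!: has_sum_cmult_right assms)
  moreover have "((\<lambda>x. f x * v) has_sum u * v) A"
    by (intro has_sum_cmult_left assms)
  ultimately show ?thesis
    using S has_sum_unique by blast
qed

section \<open>The fourfold series\<close>

text \<open>
  The part of the fourfold term that is constant in the two inner indices \<open>n\<close> and \<open>m\<close>.
\<close>

definition outer_coeff :: "real \<Rightarrow> complex \<Rightarrow> complex \<Rightarrow> complex \<Rightarrow> complex \<Rightarrow> nat \<Rightarrow> nat \<Rightarrow> complex" where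
  "outer_coeff q y a t s l i =
     (-1) ^ (i + l) * of_real q ^ ((i + l) choose 2) * qpoch a q (i + l)
     * ((y * s) ^ l / qpoch (of_real q) q l) * ((y * t) ^ i / qpoch (of_real q) q i)"

definition euler_term :: "real \<Rightarrow> complex \<Rightarrow> nat \<Rightarrow> complex" where
  "euler_term q z n = z ^ n / qpoch (of_real q) q n"

text \<open>
  The indices are paired as outer \<open>(l, i)\<close> and inner \<open>(n, m)\<close> so that summing over the second
  component yields two Euler series; \<open>l\<close> comes before \<open>i\<close> since it is the outer index
  of the hypergeometric side.
\<close>

definition fourfold_term ::
  "real \<Rightarrow> complex \<Rightarrow> complex \<Rightarrow> complex \<Rightarrow> complex \<Rightarrow> complex \<Rightarrow> (nat \<times> nat) \<times> (nat \<times> nat) \<Rightarrow> complex" where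
  "fourfold_term q x y a t s = (\<lambda>((l, i), (n, m)).
     outer_coeff q y a t s l i * (euler_term q (x * t) n * euler_term q (x * s * of_real q ^ i) m))"

text \<open>
  Dropping the summand \<open>i l\<close> of the exponent \<open>i + l\<close> choose 2 decouples the two indices.
\<close>

lemma outer_coeff_bound:
  assumes "0 < q" "q < 1"
  obtains M where "M > 0"
    "\<And>l i. norm (outer_coeff q y a t s l i)
       \<le> M * (q ^ (l choose 2) * norm (y * s) ^ l * (q ^ (i choose 2) * norm (y * t) ^ i))"
proof -
  obtain A where A: "A > 0" "\<And>n. norm (qpoch a q n) \<le> A"
    using qpoch_bounded[OF assms] by blast
  obtain K where K: "K > 0" "\<And>n. norm (inverse (qpoch (of_real q) q n)) \<le> K"
    using inverse_qpoch_self_bounded[OF assms] by blast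
  have "norm (outer_coeff q y a t s l i)
     \<le> A * K * K * (q ^ (l choose 2) * norm (y * s) ^ l * (q ^ (i choose 2) * norm (y * t) ^ i))" for l i
  proof -
    have "q ^ ((i + l) choose 2) \<le> q ^ ((i choose 2) + (l choose 2))"
      unfolding choose_two_add using assms by (intro power_decreasing) auto
    hence g: "q ^ ((i + l) choose 2) \<le> q ^ (i choose 2) * q ^ (l choose 2)"
      by (simp add: power_add)
    have "norm (outer_coeff q y a t s l i)
        = q ^ ((i + l) choose 2) * (norm (qpoch a q (i + l)) * norm (inverse (qpoch (of_real q) q l))
            * norm (inverse (qpoch (of_real q) q i))) * (norm (y * s) ^ l * norm (y * t) ^ i)"
      unfolding outer_coeff_def divide_inverse using assms
      by (simp only: norm_mult norm_power norm_of_real norm_minus_cancel norm_one power_one abs_of_pos mult_ac mult_1)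
    also have "\<dots> \<le> (q ^ (i choose 2) * q ^ (l choose 2)) * (A * K * K) * (norm (y * s) ^ l * norm (y * t) ^ i)"
      using A K g assms by (intro mult_mono mult_nonneg_nonneg) auto
    finally show ?thesis by (simp only: mult_ac)
  qed
  thus ?thesis using that[of "A * K * K"] A K by simp
qed

lemma fourfold_summable:
  assumes "0 < q" "q < 1" "norm (x * t) < 1" "norm (x * s) < 1"
  shows "fourfold_term q x y a t s summable_on UNIV"
proof -
  obtain M where M: "M > 0"
    "\<And>l i. norm (outer_coeff q y a t s l i)
       \<le> M * (q ^ (l choose 2) * norm (y * s) ^ l * (q ^ (i choose 2) * norm (y * t) ^ i))"
    using outer_coeff_bound[OF assms(1,2)] by blast
  define G where "G = (\<lambda>r n. q ^ (n choose 2) * norm (r::complex) ^ n)"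
  have G: "G r summable_on UNIV" "G r n \<ge> 0" for r n
    using summable_gaussian_power[OF assms(1,2), of "norm r"] assms
    by (auto simp: G_def summable_on_UNIV_nonneg_real_iff)
  define E where "E = (\<lambda>z n. norm (euler_term q z n))"
  have E: "E z summable_on UNIV" if "norm z < 1" for z
    using euler_summable[OF assms(1,2) that]
    by (simp add: E_def euler_term_def summable_on_UNIV_nonneg_real_iff)
  have E_nonneg: "E z n \<ge> 0" for z n by (simp add: E_def)
  have E_mono: "E (x * s * of_real q ^ i) m \<le> E (x * s) m" for i m
  proof -
    have "norm (x * s * of_real q ^ i) ^ m \<le> norm (x * s) ^ m"
      by (intro power_mono norm_mult_power_le assms) auto
    thus ?thesis
      unfolding E_def euler_term_def norm_divide norm_power by (intro divide_right_mono) auto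
  qed
  define B where "B = (\<lambda>((l, i), (n, m)). M * ((case (l, i) of (l, i) \<Rightarrow> G (y * s) l * G (y * t) i)
       * (case (n, m) of (n, m) \<Rightarrow> E (x * t) n * E (x * s) m)))"
  have "(\<lambda>(p, r). (case p of (l, i) \<Rightarrow> G (y * s) l * G (y * t) i)
            * (case r of (n, m) \<Rightarrow> E (x * t) n * E (x * s) m)) summable_on ((UNIV \<times> UNIV) \<times> (UNIV \<times> UNIV))"
    by (intro summable_on_Times_mult G E assms) (auto simp: E_nonneg G)
  from summable_on_cmult_right[OF this, of M]
  have "B summable_on UNIV"
    by (simp add: B_def case_prod_unfold)
  hence "(\<lambda>p. norm (fourfold_term q x y a t s p)) summable_on UNIV"
  proof (rule Infinite_Sum.abs_summable_on_comparison_test')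
    fix p :: "(nat \<times> nat) \<times> (nat \<times> nat)"
    obtain l i n m where p: "p = ((l, i), (n, m))" by (metis surj_pair)
    have "norm (fourfold_term q x y a t s p)
        = norm (outer_coeff q y a t s l i) * (E (x * t) n * E (x * s * of_real q ^ i) m)"
      by (simp add: p fourfold_term_def norm_mult E_def)
    also have "\<dots> \<le> (M * (G (y * s) l * G (y * t) i)) * (E (x * t) n * E (x * s) m)"
      unfolding G_def using M(1) E_nonneg assms
      by (intro mult_mono M(2) E_mono mult_nonneg_nonneg order_refl) auto
    finally show "norm (fourfold_term q x y a t s p) \<le> B p"
      by (simp add: p B_def)
  qed
  thus ?thesis by (rule abs_summable_summable)
qed

text \<open>
  This is where q-Vandermonde enters: it turns the single sum over \<open>j\<close> up to \<open>n + m\<close> into a sum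
  over a rectangle, and \<open>n - i\<close> and \<open>m - l\<close> become the inner indices of the fourfold series.
\<close>

lemma gen_cauchy_poly_expansion:
  assumes "0 < q" "q < 1"
  shows "gen_cauchy_poly q (n + m) x y a * (t ^ n / qpoch (of_real q) q n) * (s ^ m / qpoch (of_real q) q m)
     = (\<Sum>(i, l)\<in>{..n} \<times> {..m}. fourfold_term q x y a t s ((l, i), (n - i, m - l)))"
proof -
  define g where "g = (\<lambda>j. (-1) ^ j * of_real q ^ (j choose 2) * qpoch a q j * x ^ (n + m - j) * y ^ j)"
  let ?u = "(t ^ n / qpoch (of_real q) q n) * (s ^ m / qpoch (of_real q) q m)"
  have "gen_cauchy_poly q (n + m) x y a = (\<Sum>j\<le>n + m. qbinom q (n + m) j * g j)"
    by (simp add: gen_cauchy_poly_def g_def mult.assoc)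
  also have "\<dots> = (\<Sum>(i, l)\<in>{..n} \<times> {..m}.
                     qbinom q n i * qbinom q m l * of_real q ^ (i * (m - l)) * g (i + l))"
    by (subst q_vandermonde_sum[OF assms]) (rule sum.cartesian_product)
  finally have "gen_cauchy_poly q (n + m) x y a * ?u = (\<Sum>(i, l)\<in>{..n} \<times> {..m}.
                     qbinom q n i * qbinom q m l * of_real q ^ (i * (m - l)) * g (i + l) * ?u)"
    by (simp only: sum_distrib_right case_prod_unfold)
  also have "\<dots> = (\<Sum>(i, l)\<in>{..n} \<times> {..m}. fourfold_term q x y a t s ((l, i), (n - i, m - l)))"
  proof (intro sum.cong refl)
    fix p assume p: "p \<in> {..n} \<times> {..m}"
    obtain i l where il: "p = (i, l)" by (metis surj_pair)
    from p have "i \<in> {..n}" "l \<in> {..m}" by (auto simp: il)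
    then obtain n' m' where nm: "n = n' + i" "m = m' + l"
      by (metis add.commute atMost_iff le_Suc_ex)
    have *: "n' + i + (m' + l) - (i + l) = n' + m'" by simp
    have "qbinom q n i * qbinom q m l * of_real q ^ (i * (m - l)) * g (i + l) * ?u
        = fourfold_term q x y a t s ((l, i), (n - i, m - l))"
      using qpoch_self_nonzero[OF assms]
      unfolding nm g_def fourfold_term_def outer_coeff_def euler_term_def qbinom_def *
      by (simp add: field_simps power_add power_mult_distrib power_mult[symmetric])
    thus "(case p of (i, l) \<Rightarrow> qbinom q n i * qbinom q m l * of_real q ^ (i * (m - l)) * g (i + l) * ?u)
        = (case p of (i, l) \<Rightarrow> fourfold_term q x y a t s ((l, i), (n - i, m - l)))"
      by (simp only: il prod.case)
  qed
  finally show ?thesis by (simp only: mult.assoc)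
qed

text \<open>
  With two upper and two lower parameters the Gaussian factor occurs to the first power, so the
  series converges for every argument \<open>z\<close>.
\<close>

lemma bhyp_term_norm_summable:
  assumes "0 < q" "q < 1"
  shows "summable (\<lambda>i. norm (bhyp_term [b, c] [0, 0] q z i))"
proof -
  obtain B where B: "B > 0" "\<And>n. norm (qpoch b q n) \<le> B"
    using qpoch_bounded[OF assms] by blast
  obtain C where C: "C > 0" "\<And>n. norm (qpoch c q n) \<le> C"
    using qpoch_bounded[OF assms] by blast
  obtain K where K: "K > 0" "\<And>n. norm (inverse (qpoch (of_real q) q n)) \<le> K"
    using inverse_qpoch_self_bounded[OF assms] by blast
  show ?thesis
  proof (rule summable_comparison_test'[where N = 0])
    show "summable (\<lambda>i. (B * C * K) * (q ^ (i choose 2) * norm z ^ i))"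
      by (intro summable_mult summable_gaussian_power assms)
    fix i
    have "norm (bhyp_term [b, c] [0, 0] q z i)
        = (norm (qpoch b q i) * norm (qpoch c q i) * norm (inverse (qpoch (of_real q) q i)))
           * (q ^ (i choose 2) * norm z ^ i)"
      using assms by (simp add: bhyp_term_def qpoch_list_def norm_mult norm_divide norm_power
        norm_inverse divide_inverse mult_ac)
    also have "\<dots> \<le> (B * C * K) * (q ^ (i choose 2) * norm z ^ i)"
      using B C K assms by (intro mult_mono mult_nonneg_nonneg order_refl) auto
    finally show "norm (norm (bhyp_term [b, c] [0, 0] q z i)) \<le> \<dots>" by simp
  qed
qed

lemma outer_coeff_bhyp_term:
  "outer_coeff q y a t s l i * qpoch (x * s) q i
     = ((-1) ^ l * of_real q ^ (l choose 2) * qpoch a q l * (s * y) ^ l / qpoch (of_real q) q l)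
       * bhyp_term [a * of_real q ^ l, x * s] [0, 0] q (y * t * of_real q ^ l) i"
proof -
  have "qpoch a q (i + l) = qpoch a q l * qpoch (a * of_real q ^ l) q i"
    by (simp add: qpoch_add add.commute[of i])
  moreover have "complex_of_real q ^ ((i + l) choose 2)
      = of_real q ^ (i choose 2) * of_real q ^ (l choose 2) * (of_real q ^ l) ^ i"
    by (simp add: choose_two_add power_add power_mult[symmetric] mult.commute)
  ultimately show ?thesis
    by (simp add: outer_coeff_def bhyp_term_def qpoch_list_def power_add power_mult_distrib mult_ac)
qed

theorem theorem2p4:
  fixes q :: real and x y a t s :: complex
  defines "L \<equiv> \<lambda>n m. gen_cauchy_poly q (n + m) x y a
                     * (t ^ n / qpoch (of_real q) q n) * (s ^ m / qpoch (of_real q) q m)"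
    and "R \<equiv> \<lambda>n. ((-1) ^ n * of_real q ^ (n choose 2) * qpoch a q n * (s * y) ^ n
                     / qpoch (of_real q) q n)
                  * bhyp [a * of_real q ^ n, x * s] [0, 0] q (y * t * of_real q ^ n)"
  assumes "0 < q" and "q < 1"
    and "max (norm (x * t)) (norm (x * s)) < 1"
  shows "(\<forall>n. summable (\<lambda>m. L n m)) \<and> summable (\<lambda>n. \<Sum>m. L n m)
    \<and> (\<forall>n. summable (bhyp_term [a * of_real q ^ n, x * s] [0, 0] q (y * t * of_real q ^ n)))
    \<and> summable R
    \<and> (\<Sum>n. \<Sum>m. L n m) = 1 / qpoch_inf_list [x * t, x * s] q * (\<Sum>n. R n)"
proof -
  note q = \<open>0 < q\<close> \<open>q < 1\<close>
  have xt: "norm (x * t) < 1" and xs: "norm (x * s) < 1" using assms by auto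
  let ?T = "fourfold_term q x y a t s"
  obtain S where S: "(?T has_sum S) UNIV"
    using fourfold_summable[OF q xt xs] by (auto simp: summable_on_def)

  \<comment> \<open>First grouping: fix \<open>n = n' + i\<close> and \<open>m = m' + l\<close>, leaving finitely many \<open>(i, l)\<close>.\<close>
  have "((\<lambda>((n, m), (i, l)). ?T ((l, i), (n - i, m - l))) has_sum S)
          (Sigma UNIV (\<lambda>(n, m). {..n} \<times> {..m}))"
    by (rule iffD2[OF has_sum_reindex_bij_witness[where T = UNIV and h = ?T
          and j = "\<lambda>((n, m), (i, l)). ((l, i), (n - i, m - l))"
          and i = "\<lambda>((l, i), (n', m')). ((n' + i, m' + l), (i, l))"] S]) auto
  hence "((\<lambda>(n, m). L n m) has_sum S) UNIV"
  proof (rule has_sum_SigmaD)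
    fix p :: "nat \<times> nat"
    obtain n m where p: "p = (n, m)" by (metis surj_pair)
    show "((\<lambda>r. (\<lambda>((n, m), (i, l)). ?T ((l, i), (n - i, m - l))) (p, r))
             has_sum (case p of (n, m) \<Rightarrow> L n m)) (case p of (n, m) \<Rightarrow> {..n} \<times> {..m})"
      unfolding p L_def prod.case gen_cauchy_poly_expansion[OF q] by (intro has_sum_finite) auto
  qed
  hence L: "((\<lambda>(n, m). L n m) has_sum S) (UNIV \<times> UNIV)" by simp
  have L_row: "L n summable_on UNIV" for n
    using summable_on_SigmaD1[OF has_sum_imp_summable[OF L], of n] by simp
  have L_row_sum: "(\<Sum>m. L n m) = infsum (L n) UNIV" for n
    using has_sum_imp_sums[OF has_sum_infsum[OF L_row]] by (simp add: sums_iff)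
  have "((\<lambda>n. \<Sum>m. L n m) has_sum S) UNIV"
    unfolding L_row_sum by (rule has_sum_SigmaD[OF L]) (simp add: L_row)
  hence L_sums: "(\<lambda>n. \<Sum>m. L n m) sums S" by (rule has_sum_imp_sums)

  \<comment> \<open>Second grouping: for fixed \<open>(l, i)\<close>, sum over all \<open>(n', m')\<close> by Euler's expansion.\<close>
  define c where "c = qpoch_inf_list [x * t, x * s] q"
  have c: "c = qpoch_inf (x * t) q * qpoch_inf (x * s) q"
    by (simp add: c_def qpoch_inf_list_def)
  have c_nz: "c \<noteq> 0" unfolding c using qpoch_inf_nonzero q xt xs by simp
  let ?P = "\<lambda>l. (-1) ^ l * of_real q ^ (l choose 2) * qpoch a q l * (s * y) ^ l / qpoch (of_real q) q l"
  let ?b = "\<lambda>l. bhyp_term [a * of_real q ^ l, x * s] [0, 0] q (y * t * of_real q ^ l)"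
  have euler: "(euler_term q z has_sum 1 / qpoch_inf z q) UNIV" if "norm z < 1" for z
    using norm_summable_imp_has_sum[OF euler_summable[OF q that] euler_sum[OF q that]]
    by (simp add: euler_term_def[abs_def])
  have inner: "((\<lambda>r. ?T ((l, i), r)) has_sum 1 / c * (?P l * ?b l i)) (UNIV \<times> UNIV)" for l i
  proof -
    let ?z = "x * s * of_real q ^ i"
    have z: "norm ?z < 1" using norm_mult_power_le[OF q, of "x * s" i] xs by simp
    have "(\<lambda>(n, m). euler_term q (x * t) n * euler_term q ?z m) summable_on (UNIV \<times> UNIV)"
    proof (rule abs_summable_summable)
      have "(\<lambda>(n, m). norm (euler_term q (x * t) n) * norm (euler_term q ?z m)) summable_on (UNIV \<times> UNIV)"
        using euler_summable[OF q xt] euler_summable[OF q z]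
        by (intro summable_on_Times_mult) (auto simp: euler_term_def summable_on_UNIV_nonneg_real_iff)
      thus "(\<lambda>p. norm (case p of (n, m) \<Rightarrow> euler_term q (x * t) n * euler_term q ?z m)) summable_on (UNIV \<times> UNIV)"
        by (simp add: case_prod_unfold norm_mult)
    qed
    from has_sum_cmult_right[OF has_sum_Times_mult[OF this euler[OF xt] euler[OF z]]]
    have "((\<lambda>r. ?T ((l, i), r)) has_sum
            outer_coeff q y a t s l i * (1 / qpoch_inf (x * t) q * (1 / qpoch_inf ?z q))) (UNIV \<times> UNIV)"
      by (simp add: fourfold_term_def case_prod_unfold)
    also have "outer_coeff q y a t s l i * (1 / qpoch_inf (x * t) q * (1 / qpoch_inf ?z q))
        = 1 / c * (outer_coeff q y a t s l i * qpoch (x * s) q i)"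
      using c_nz qpoch_inf_split[OF q, of "x * s" i] unfolding c by (auto simp: divide_simps)
    finally show ?thesis unfolding outer_coeff_bhyp_term .
  qed
  have rows: "((\<lambda>(l, i). 1 / c * (?P l * ?b l i)) has_sum S) (UNIV \<times> UNIV)"
    by (rule has_sum_SigmaD[where f = ?T and B = "\<lambda>_. UNIV \<times> UNIV"]) (use S inner in auto)
  have row_sum: "((\<lambda>i. 1 / c * (?P l * ?b l i)) has_sum 1 / c * R l) UNIV" for l
    unfolding R_def bhyp_def
    by (intro has_sum_cmult_right norm_summable_imp_has_sum summable_sums
          bhyp_term_norm_summable[OF q] summable_norm_cancel[OF bhyp_term_norm_summable[OF q]])
  have "((\<lambda>l. 1 / c * R l) has_sum S) UNIV"
    by (rule has_sum_SigmaD[OF rows]) (simp only: prod.case row_sum)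
  from sums_mult[OF has_sum_imp_sums[OF this], of c] have "R sums (c * S)"
    using c_nz by simp
  hence R: "summable R" "(\<Sum>n. R n) = c * S" by (simp_all add: sums_iff)

  show ?thesis
    using L_row L_sums R c_nz summable_norm_cancel[OF bhyp_term_norm_summable[OF q]]
    by (simp add: summable_on_imp_summable sums_iff flip: c_def)
qed

end
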